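(* There is a function $F\colon\mathbb{N}\to\mathbb{N}$ such that for any $k\in\mathbb{N}$ and any $n$-gon $\mathcal{P}$ with $n\ge F(k)$ there is a convex sub-$k$-gon of $\mathcal{P}$.
   Context: $\mathbb{N}=\{1,2,3,\dots\}$. A polygon, or more specifically an $n$-gon, is any finite sequence $\mathcal{P}=(V_0,\dots,V_{n-1})$ of points (called vertices) in the Euclidean plane $\mathbb{R}^2$; the points need not be distinct nor in general position, and the order of the sequence matters. The edges of $\mathcal{P}$ are the closed segments $[V_i,V_{i+1}]:=\operatorname{conv}\{V_i,V_{i+1}\}$ for $i\in\{0,\dots,n-1\}$, where $V_n:=V_0$ and $\operatorname{conv}$ denotes the convex hull (a segment may degenerate to a point). The convex hull of the polygon is $\operatorname{conv}\mathcal{P}:=\operatorname{conv}\{V_0,\dots,V_{n-1}\}$. The polygon $\mathcal{P}$ is convex if the union of its edges coincides with the boundary (in $\mathbb{R}^2$) of $\operatorname{conv}\mathcal{P}$. A sub-$k$-gon of $\mathcal{P}=(V_0,\dots,V_{n-1})$ is any subsequence $(V_{i_0},\dots,V_{i_{k-1}})$ with $0\le i_0<\dots<i_{k-1}\le n-1$, considered as a $k$-gon in its own right (so its edges are $[V_{i_0},V_{i_1}],\dots,[V_{i_{k-2}},V_{i_{k-1}}],[V_{i_{k-1}},V_{i_0}]$). *)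

theory Defs
  imports "HOL-Analysis.Analysis" "HOL-Library.Sublist"
begin

text \<open>An \<open>n\<close>-gon is a list of \<open>n\<close> points of the plane; repetitions and degenerate
  configurations are allowed. A sub-\<open>k\<close>-gon of \<open>P\<close> is a list \<open>Q\<close> of length \<open>k\<close> with
  \<^term>\<open>subseq Q P\<close> (order-preserving, not necessarily contiguous).\<close>

type_synonym polygon = "(real^2) list"

text \<open>The reduction modulo the length makes the last edge join the last vertex to the first one.\<close>

definition polygon_edge :: "polygon \<Rightarrow> nat \<Rightarrow> (real^2) set" where
  "polygon_edge P i = closed_segment (P ! i) (P ! (Suc i mod length P))"

definition convex_polygon :: "polygon \<Rightarrow> bool" where
  "convex_polygon P \<longleftrightarrow> (\<Union>i<length P. polygon_edge P i) = frontier (convex hull (set P))"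

end

theory Submission
  imports Defs "HOL-Library.Ramsey"
begin

text \<open>Colour the triples of indices \<open>i < j < k\<close> by the orientation (positive, negative or zero) of
  the triangle \<open>V\<^sub>i V\<^sub>j V\<^sub>k\<close>. Ramsey's theorem for triples gives \<open>k\<close> vertices all of
  whose triples have the same colour. With colour zero they lie on a line, and the union of the
  edges, being connected and collinear, is the whole hull, which is its own boundary. Otherwise
  each edge supports the hull, and conversely a supporting line contains at most two
  vertices, which must be cyclically adjacent since all others lie on the same side of it.\<close>

section \<open>Orientation of triples of points in the plane\<close>

text \<open>Twice the signed area of the triangle \<open>A B C\<close>, positive when it runs
  counterclockwise.\<close>

definition orient :: "real^2 \<Rightarrow> real^2 \<Rightarrow> real^2 \<Rightarrow> real" where
  "orient A B C = (B$1 - A$1) * (C$2 - A$2) - (B$2 - A$2) * (C$1 - A$1)"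

lemma orient_rotate: "orient A B C = orient B C A"
  by (simp add: orient_def algebra_simps)

lemma orient_swap: "orient A B C = - orient A C B"
  by (simp add: orient_def algebra_simps)

lemma orient_degenerate [simp]: "orient A A C = 0" "orient A B A = 0" "orient A B B = 0"
  by (simp_all add: orient_def)

text \<open>The vector on the right is \<open>B - A\<close> turned by a right angle, so it is a
  normal of the line through \<open>A\<close> and \<open>B\<close>.\<close>

lemma orient_eq_inner: "orient A B P = vector [A$2 - B$2, B$1 - A$1] \<bullet> (P - A)"
  by (simp add: orient_def inner_vec_def sum_2 algebra_simps)

text \<open>In the plane the vectors orthogonal to \<open>B - A\<close> form a line, so
  \<open>a\<close> is a multiple of the normal behind \<open>orient\<close>. This turns statements
  about a supporting line into signs of orientations.\<close>

lemma inner_proportional_orient: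
  fixes a :: "real^2"
  assumes "A \<noteq> B" and eq: "a \<bullet> A = a \<bullet> B"
  obtains t where "\<And>P. a \<bullet> P - a \<bullet> A = t * orient A B P"
proof -
  define d where "d = B - A"
  have ad: "a$1 * d$1 + a$2 * d$2 = 0"
    using eq by (simp add: d_def inner_vec_def sum_2 algebra_simps)
  have "d \<noteq> 0"
    using assms by (simp add: d_def)
  then have "d$1 \<noteq> 0 \<or> d$2 \<noteq> 0"
    by (simp add: vec_eq_iff forall_2)
  then obtain t where t: "a$1 = - t * d$2" "a$2 = t * d$1"
  proof
    assume d: "d$1 \<noteq> 0"
    show thesis
      by (rule that[of "a$2 / d$1"]) (use d ad in \<open>simp_all add: field_simps\<close>)
  next
    assume d: "d$2 \<noteq> 0"
    show thesis
      by (rule that[of "- a$1 / d$2"]) (use d ad in \<open>simp_all add: field_simps\<close>)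
  qed
  have "a \<bullet> P - a \<bullet> A = t * orient A B P" for P
    unfolding inner_diff_right[symmetric]
    by (simp add: t orient_def d_def inner_vec_def sum_2 algebra_simps)
  then show thesis
    by (rule that)
qed

lemma orient_zero_imp_collinear:
  assumes "orient A B C = 0"
  shows "collinear {A, B, C}"
proof (cases "A = B")
  case True
  then show ?thesis by simp
next
  case False
  define d where "d = B - A"
  have ad: "d$1 * (C$2 - A$2) = d$2 * (C$1 - A$1)"
    using assms by (simp add: orient_def d_def)
  have "d$1 \<noteq> 0 \<or> d$2 \<noteq> 0"
    using False by (auto simp: d_def vec_eq_iff forall_2)
  then obtain t where "C - A = t *\<^sub>R d"
  proof
    assume d: "d$1 \<noteq> 0"
    show thesis
      by (rule that[of "(C$1 - A$1) / d$1"]) (use d ad in \<open>simp add: vec_eq_iff forall_2 field_simps\<close>)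
  next
    assume d: "d$2 \<noteq> 0"
    show thesis
      by (rule that[of "(C$2 - A$2) / d$2"]) (use d ad in \<open>simp add: vec_eq_iff forall_2 field_simps\<close>)
  qed
  then have "collinear {0, B - A, C - A}"
    unfolding collinear_lemma d_def by blast
  then have "collinear {B, A, C}"
    using collinear_3[of B A C] by (simp add: NO_MATCH_def)
  then show ?thesis
    by (simp add: insert_commute)
qed

text \<open>The hypothesis speaks only of increasing triples of indices; the antisymmetry of
  \<open>orient\<close> extends it to all triples. If two vertices differ, every other vertex lies
  on the line through them.\<close>

lemma collinear_orient_zero:
  assumes z: "\<And>i j k. i < j \<Longrightarrow> j < k \<Longrightarrow> k < length Q \<Longrightarrow> orient (Q ! i) (Q ! j) (Q ! k) = 0"
  shows "collinear (set Q)"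
proof -
  have z': "orient (Q ! i) (Q ! j) (Q ! k) = 0"
    if "i < length Q" "j < length Q" "k < length Q" for i j k
    using that z[of i j k] z[of i k j] z[of j i k] z[of j k i] z[of k i j] z[of k j i]
      orient_rotate[of "Q!i" "Q!j" "Q!k"] orient_rotate[of "Q!j" "Q!k" "Q!i"]
      orient_rotate[of "Q!i" "Q!k" "Q!j"] orient_rotate[of "Q!k" "Q!j" "Q!i"]
      orient_swap[of "Q!i" "Q!j" "Q!k"]
    by (cases i j rule: linorder_cases; cases j k rule: linorder_cases;
        cases i k rule: linorder_cases; simp)
  have c: "collinear {A, B, C}" if "A \<in> set Q" "B \<in> set Q" "C \<in> set Q" for A B C
    using that z' by (metis in_set_conv_nth orient_zero_imp_collinear)
  show ?thesis
  proof (cases "\<exists>A\<in>set Q. \<exists>B\<in>set Q. A \<noteq> B")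
    case True
    then obtain A B where AB: "A \<in> set Q" "B \<in> set Q" "A \<noteq> B"
      by blast
    then have "collinear (insert A (insert B (set Q)))"
      using collinear_triples[OF AB(3)] c by blast
    then show ?thesis
      using AB by (simp add: insert_absorb)
  next
    case False
    then have "set Q \<subseteq> {hd Q, hd Q}"
      by (cases Q) auto
    then show ?thesis
      by (meson collinear_2 collinear_subset)
  qed
qed

section \<open>Collinear polygons\<close>

lemma polygon_edge_subset_hull:
  assumes "i < length Q"
  shows "polygon_edge Q i \<subseteq> convex hull (set Q)"
proof -
  have "Suc i mod length Q < length Q"
    using assms by (intro mod_less_divisor) linarith
  then have "{Q ! i, Q ! (Suc i mod length Q)} \<subseteq> set Q"
    using assms by simp
  then show ?thesis
    unfolding polygon_edge_def segment_convex_hull by (rule hull_mono)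
qed

lemma convex_polygon_collinear:
  assumes col: "collinear (set Q)" and ne: "Q \<noteq> []"
  shows "convex_polygon Q"
proof -
  let ?U = "\<lambda>m. \<Union>i<m. polygon_edge Q i"
  let ?n = "length Q"
  have U: "?U ?n \<subseteq> convex hull (set Q)"
    using polygon_edge_subset_hull by blast
  \<comment> \<open>Induction on the number of edges taken. The last clause keeps track of the end
    of the latest edge, the point where the next edge attaches.\<close>
  have "connected (?U m) \<and> (\<forall>i<m. Q ! i \<in> ?U m) \<and> (m > 0 \<longrightarrow> Q ! (m mod ?n) \<in> ?U m)"
    if "m \<le> ?n" for m
    using that
  proof (induction m)
    case 0
    then show ?case by simp
  next
    case (Suc m)
    have e: "connected (polygon_edge Q m)" "Q ! m \<in> polygon_edge Q m"
      "Q ! (Suc m mod ?n) \<in> polygon_edge Q m"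
      by (simp_all add: polygon_edge_def)
    have *: "?U (Suc m) = ?U m \<union> polygon_edge Q m"
      by (simp add: lessThan_Suc Un_commute)
    have "connected (?U (Suc m))"
    proof (cases "m = 0")
      case True
      then show ?thesis using e * by simp
    next
      case False
      then have "Q ! m \<in> ?U m"
        using Suc by simp
      then show ?thesis
        unfolding * using Suc e by (intro connected_Un) auto
    qed
    then show ?case
      using Suc e unfolding * by (auto simp: less_Suc_eq)
  qed
  then have conn: "connected (?U ?n)" and sub: "set Q \<subseteq> ?U ?n"
    by (auto simp: in_set_conv_nth)
  have colh: "collinear (convex hull (set Q))"
    using col by (meson collinear_affine_hull_collinear collinear_subset convex_hull_subset_affine_hull)
  then have "convex (?U ?n)"
    using conn U collinear_subset convex_connected_collinear by blast
  then have "?U ?n = convex hull (set Q)"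
    using U sub by (simp add: hull_minimal subset_antisym)
  \<comment> \<open>A collinear set has affine dimension at most 1, while nonempty interior in the
    plane would force dimension 2.\<close>
  moreover have "interior (convex hull (set Q)) = {}"
    using colh aff_dim_nonempty_interior[of "convex hull (set Q)"] by (force simp: collinear_aff_dim)
  then have "frontier (convex hull (set Q)) = convex hull (set Q)"
    by (simp add: frontier_def closure_closed finite_imp_compact_convex_hull compact_imp_closed)
  ultimately show ?thesis
    by (simp add: convex_polygon_def)
qed

section \<open>Supporting hyperplanes of convex sets and hulls\<close>

text \<open>If the interior is empty, \<open>S\<close> lies in a hyperplane, whose normal works at
  every point. Otherwise interior and relative interior agree, and the result for the relative
  boundary applies.\<close>

lemma supporting_hyperplane_frontier:
  fixes S :: "'a::euclidean_space set"
  assumes "convex S" "closed S" "x \<in> frontier S"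
  obtains a where "a \<noteq> 0" "\<And>y. y \<in> S \<Longrightarrow> a \<bullet> x \<le> a \<bullet> y"
proof -
  have x: "x \<in> S" "x \<notin> interior S"
    using assms by (auto simp: frontier_def)
  show thesis
  proof (cases "interior S = {}")
    case True
    then obtain a b where "a \<noteq> 0" "S \<subseteq> {x. a \<bullet> x = b}"
      using empty_interior_subset_hyperplane[OF \<open>convex S\<close>] by metis
    then show ?thesis
      using x that[of a] by (metis (mono_tags) mem_Collect_eq order_refl subsetD)
  next
    case False
    then have "x \<notin> rel_interior S"
      using x rel_interior_nonempty_interior by blast
    then show ?thesis
      using supporting_hyperplane_rel_boundary[OF \<open>convex S\<close>] x that by metis
  qed
qed

text \<open>The supporting hyperplane cuts out a face, and a face of the hull of a finite set is the
  hull of some of its generators.\<close>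

lemma convex_hull_supporting_hyperplane:
  fixes S :: "'a::euclidean_space set"
  assumes "finite S" "x \<in> convex hull S" and a: "\<And>y. y \<in> convex hull S \<Longrightarrow> a \<bullet> x \<le> a \<bullet> y"
  shows "x \<in> convex hull {y \<in> S. a \<bullet> y = a \<bullet> x}"
proof -
  let ?T = "convex hull S \<inter> {y. a \<bullet> y = a \<bullet> x}"
  have "?T face_of convex hull S"
    using a by (intro face_of_Int_supporting_hyperplane_ge) auto
  then obtain S' where S': "S' \<subseteq> S" "?T = convex hull S'"
    using assms by (metis face_of_convex_hull_subset finite_imp_compact)
  have "S' \<subseteq> ?T"
    using S' hull_subset by metis
  then have "S' \<subseteq> {y \<in> S. a \<bullet> y = a \<bullet> x}"
    using S' by blast
  moreover have "x \<in> convex hull S'"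
    using assms S' by blast
  ultimately show ?thesis
    using hull_mono by blast
qed

section \<open>Polygons whose increasing triples all have the same strict orientation\<close>

text \<open>The factor \<open>\<sigma>\<close> treats the counterclockwise and the clockwise case
  together.\<close>

locale oriented_polygon =
  fixes Q :: polygon and \<sigma> :: real
  assumes length_ge_3: "3 \<le> length Q"
    and oriented: "\<And>i j k. \<lbrakk>i < j; j < k; k < length Q\<rbrakk> \<Longrightarrow> 0 < \<sigma> * orient (Q ! i) (Q ! j) (Q ! k)"
begin

text \<open>The ends of an edge followed by a third vertex form a cyclic shift of an increasing
  triple, also for the closing edge. The value is zero when \<open>Q ! j\<close> is an end of the
  edge.\<close>

lemma polygon_edge_orient_nonneg:
  assumes "i < length Q" "j < length Q"
  shows "0 \<le> \<sigma> * orient (Q ! i) (Q ! (Suc i mod length Q)) (Q ! j)"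
proof (cases "Suc i < length Q")
  case True
  consider "j < i" | "j = i" | "j = Suc i" | "Suc i < j"
    by linarith
  then show ?thesis
  proof cases
    case 1
    then have "0 < \<sigma> * orient (Q ! j) (Q ! i) (Q ! Suc i)"
      using True by (intro oriented) auto
    then show ?thesis
      using True by (simp add: orient_rotate[of "Q ! j"])
  next
    case 4
    then have "0 < \<sigma> * orient (Q ! i) (Q ! Suc i) (Q ! j)"
      using assms by (intro oriented) auto
    then show ?thesis
      using True by simp
  qed (use True in simp_all)
next
  case False
  then have i: "Suc i = length Q"
    using assms by simp
  consider "j = 0" | "j = i" | "0 < j" "j < i"
    using assms i by linarith
  then show ?thesis
  proof cases
    case 3
    then have "0 < \<sigma> * orient (Q ! 0) (Q ! j) (Q ! i)"
      using assms by (intro oriented) auto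
    then show ?thesis
      using i by (simp add: orient_rotate[of "Q ! i"])
  qed (use i in simp_all)
qed

text \<open>Any two indices belong to a triple, whose orientation would vanish if their vertices
  coincided.\<close>

lemma vertices_distinct:
  assumes "i < j" "j < length Q"
  shows "Q ! i \<noteq> Q ! j"
proof -
  obtain l where l: "l < length Q" "l \<noteq> i" "l \<noteq> j"
  proof -
    have "\<exists>l<3. l \<noteq> i \<and> l \<noteq> j"
      by presburger
    then show thesis
      using that length_ge_3 by (meson less_le_trans)
  qed
  then consider "l < i" | "i < l" "l < j" | "j < l"
    by linarith
  then show ?thesis
    using oriented[of l i j] oriented[of i l j] oriented[of i j l] assms l by cases auto
qed

text \<open>The line of the edge bounds a half-plane containing the hull; the interior of the hull
  lies in the open half-plane and so misses the edge.\<close>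

lemma polygon_edge_subset_frontier:
  assumes i: "i < length Q"
  shows "polygon_edge Q i \<subseteq> frontier (convex hull (set Q))"
proof
  fix x
  assume x: "x \<in> polygon_edge Q i"
  let ?A = "Q ! i" and ?B = "Q ! (Suc i mod length Q)"
  \<comment> \<open>A normal of the edge, with \<open>\<sigma>\<close> making it point to the side
    of the polygon.\<close>
  define a where "a = \<sigma> *\<^sub>R (vector [?A$2 - ?B$2, ?B$1 - ?A$1] :: real^2)"
  have a: "a \<bullet> y - a \<bullet> ?A = \<sigma> * orient ?A ?B y" for y
    by (simp add: a_def orient_eq_inner inner_diff_right right_diff_distrib)
  have "\<sigma> \<noteq> 0"
    using oriented[of 0 1 2] length_ge_3 by auto
  have "?A \<noteq> ?B"
  proof (cases "Suc i = length Q")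
    case True
    then show ?thesis
      using vertices_distinct[of 0 i] length_ge_3 by auto
  next
    case False
    then show ?thesis
      using vertices_distinct[of i "Suc i"] i by auto
  qed
  with \<open>\<sigma> \<noteq> 0\<close> have "a \<noteq> 0"
    by (auto simp: a_def vec_eq_iff forall_2)
  have "set Q \<subseteq> {y. a \<bullet> y \<ge> a \<bullet> ?A}"
  proof
    fix y assume "y \<in> set Q"
    then obtain j where "j < length Q" "y = Q ! j"
      by (auto simp: in_set_conv_nth)
    then show "y \<in> {y. a \<bullet> y \<ge> a \<bullet> ?A}"
      using polygon_edge_orient_nonneg[OF i, of j] a[of y] by simp
  qed
  then have "convex hull (set Q) \<subseteq> {y. a \<bullet> y \<ge> a \<bullet> ?A}"
    by (intro hull_minimal convex_halfspace_ge)
  then have "interior (convex hull (set Q)) \<subseteq> {y. a \<bullet> y > a \<bullet> ?A}"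
    using interior_mono interior_halfspace_ge[OF \<open>a \<noteq> 0\<close>] by metis
  moreover have "a \<bullet> x = a \<bullet> ?A"
  proof -
    have "a \<bullet> ?B = a \<bullet> ?A"
      using a[of ?B] by simp
    then have "closed_segment ?A ?B \<subseteq> {y. a \<bullet> y = a \<bullet> ?A}"
      by (intro closed_segment_subset convex_hyperplane) auto
    then show ?thesis
      using x by (auto simp: polygon_edge_def)
  qed
  ultimately have "x \<notin> interior (convex hull (set Q))"
    by auto
  moreover have "x \<in> closure (convex hull (set Q))"
    using x polygon_edge_subset_hull[OF i] closure_subset by blast
  ultimately show "x \<in> frontier (convex hull (set Q))"
    by (simp add: frontier_def)
qed

lemma frontier_subset_polygon_edges:
  assumes x: "x \<in> frontier (convex hull (set Q))"
  shows "\<exists>i<length Q. x \<in> polygon_edge Q i"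
proof -
  have closed: "closed (convex hull (set Q))"
    by (simp add: finite_imp_compact_convex_hull compact_imp_closed)
  then have xh: "x \<in> convex hull (set Q)"
    using x by (simp add: frontier_def)
  obtain a where "a \<noteq> 0" and a: "\<And>y. y \<in> convex hull (set Q) \<Longrightarrow> a \<bullet> x \<le> a \<bullet> y"
    using supporting_hyperplane_frontier[OF convex_convex_hull closed x] by blast
  define I where "I = {i. i < length Q \<and> a \<bullet> (Q ! i) = a \<bullet> x}"
  have "{y \<in> set Q. a \<bullet> y = a \<bullet> x} = (!) Q ` I"
    by (auto simp: I_def in_set_conv_nth)
  then have xI: "x \<in> convex hull ((!) Q ` I)"
    using convex_hull_supporting_hyperplane[OF _ xh a] by simp
  then have "I \<noteq> {}"
    by auto
  moreover have "finite I"
    by (simp add: I_def)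
  ultimately have I: "finite I" "I \<noteq> {}"
    by simp_all
  \<comment> \<open>The chord between the extreme indices on the supporting line separates the
    remaining vertices: those with index strictly between \<open>i\<close> and \<open>j\<close> from
    those with index outside.\<close>
  define i j where "i = Min I" and "j = Max I"
  have ij: "i \<in> I" "j \<in> I" and between: "\<And>l. l \<in> I \<Longrightarrow> i \<le> l \<and> l \<le> j"
    using I by (auto simp: i_def j_def)
  then have "i \<le> j"
    by blast
  have len: "i < length Q" "j < length Q" and aij: "a \<bullet> (Q ! i) = a \<bullet> x" "a \<bullet> (Q ! j) = a \<bullet> x"
    using ij by (auto simp: I_def)
  show ?thesis
  proof (cases "i = j")
    case True
    then have "I = {i}"
      using ij between by force
    then have "x = Q ! i"
      using xI by simp
    then show ?thesis
      using len by (auto simp: polygon_edge_def)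
  next
    case False
    then have "i < j"
      using \<open>i \<le> j\<close> by simp
    obtain t where t: "\<And>P. a \<bullet> P - a \<bullet> (Q ! i) = t * orient (Q ! i) (Q ! j) P"
      using inner_proportional_orient[OF vertices_distinct[OF \<open>i < j\<close>]] len aij by metis
    \<comment> \<open>At \<open>P = a + Q ! i\<close> the left-hand side of \<open>t\<close> is
      \<open>a \<bullet> a\<close>, which is nonzero.\<close>
    have "t \<noteq> 0"
      using t[of "a + Q ! i"] \<open>a \<noteq> 0\<close> by (auto simp: inner_add_right)
    have side: "0 \<le> t * orient (Q ! i) (Q ! j) (Q ! l)" if "l < length Q" for l
      using a[of "Q ! l"] t[of "Q ! l"] aij that by (simp add: hull_inc)
    have inner: "\<sigma> * orient (Q ! i) (Q ! j) (Q ! l) < 0" if "i < l" "l < j" for l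
      using oriented[of i l j] that len orient_swap[of "Q ! i" "Q ! j" "Q ! l"] by simp
    have outer: "0 < \<sigma> * orient (Q ! i) (Q ! j) (Q ! l)" if "l < i \<or> j < l" "l < length Q" for l
      using oriented[of l i j] oriented[of i j l] orient_rotate[of "Q ! l" "Q ! i" "Q ! j"]
        that len \<open>i < j\<close> by auto
    have "I \<subseteq> {i, j}"
    proof
      fix l assume l: "l \<in> I"
      then have "t * orient (Q ! i) (Q ! j) (Q ! l) = 0"
        using t[of "Q ! l"] aij by (simp add: I_def)
      then have "orient (Q ! i) (Q ! j) (Q ! l) = 0"
        using \<open>t \<noteq> 0\<close> by simp
      then show "l \<in> {i, j}"
        using inner[of l] between[OF l] by force
    qed
    then have "(!) Q ` I \<subseteq> {Q ! i, Q ! j}"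
      by blast
    then have xs: "x \<in> closed_segment (Q ! i) (Q ! j)"
      using xI hull_mono unfolding segment_convex_hull by blast
    \<comment> \<open>Otherwise some index lies strictly between \<open>i\<close> and
      \<open>j\<close> and some index outside. Their vertices are strictly on opposite sides of the
      supporting line, which is impossible.\<close>
    have adj: "j = Suc i \<or> i = 0 \<and> Suc j = length Q"
    proof (rule ccontr)
      assume na: "\<not> ?thesis"
      then have m: "i < Suc i" "Suc i < j"
        using \<open>i < j\<close> by auto
      obtain l where l: "l < i \<or> j < l" "l < length Q"
      proof (cases "i = 0")
        case True
        then show ?thesis
          using na len m that[of "Suc j"] by force
      next
        case False
        then show ?thesis
          using len that[of 0] by force
      qed
      have "0 \<le> t * orient (Q ! i) (Q ! j) (Q ! Suc i)" "0 \<le> t * orient (Q ! i) (Q ! j) (Q ! l)"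
        using side l m len by auto
      then show False
        using inner[OF m] outer[OF l] \<open>t \<noteq> 0\<close>
        by (auto simp: zero_le_mult_iff mult_less_0_iff zero_less_mult_iff)
    qed
    then show ?thesis
    proof
      assume "j = Suc i"
      then have "x \<in> polygon_edge Q i"
        using xs len by (simp add: polygon_edge_def)
      then show ?thesis
        using len by blast
    next
      assume "i = 0 \<and> Suc j = length Q"
      then have "x \<in> polygon_edge Q j"
        using xs by (simp add: polygon_edge_def closed_segment_commute)
      then show ?thesis
        using len by blast
    qed
  qed
qed

lemma convex_polygon: "convex_polygon Q"
  unfolding convex_polygon_def
  using polygon_edge_subset_frontier frontier_subset_polygon_edges by blast

end

section \<open>Ramsey's theorem for triples and the choice of the sub-polygon\<close>

lemma ramsey_triples:
  fixes n c :: nat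
  shows "\<exists>N. \<forall>g :: nat \<Rightarrow> nat \<Rightarrow> nat \<Rightarrow> nat. (\<forall>x y z. g x y z < c) \<longrightarrow>
    (\<exists>H \<subseteq> {..<N}. card H = n \<and>
      (\<exists>d<c. \<forall>x\<in>H. \<forall>y\<in>H. \<forall>z\<in>H. x < y \<longrightarrow> y < z \<longrightarrow> g x y z = d))"
proof -
  obtain N :: nat where N: "partn_lst {..<N} (replicate c n) 3"
    using ramsey_full by blast
  show ?thesis
  proof (intro exI[of _ N] allI impI)
    fix g :: "nat \<Rightarrow> nat \<Rightarrow> nat \<Rightarrow> nat"
    assume g: "\<forall>x y z. g x y z < c"
    \<comment> \<open>Ramsey's theorem colours 3-element sets; listing such a set in increasing
      order turns \<open>g\<close> into a colouring of sets.\<close>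
    define f where
      "f T = (let xs = sorted_list_of_set T in g (xs ! 0) (xs ! 1) (xs ! 2))" for T
    have "f \<in> [{..<N}]\<^bsup>3\<^esup> \<rightarrow> {..<length (replicate c n)}"
      using g by (simp add: f_def Let_def)
    then obtain d H where d: "d < c" and H: "H \<in> [{..<N}]\<^bsup>n\<^esup>" and fd: "f ` [H]\<^bsup>3\<^esup> \<subseteq> {d}"
      using N unfolding partn_lst_def monochromatic_def by fastforce
    have "g x y z = d" if "x \<in> H" "y \<in> H" "z \<in> H" "x < y" "y < z" for x y z
    proof -
      have "{x, y, z} \<in> [H]\<^bsup>3\<^esup>"
        using that by (auto simp: ordered_nsets_3_eq)
      then have "f {x, y, z} = d"
        using fd by blast
      moreover have "sorted_list_of_set {x, y, z} = [x, y, z]"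
        using that by simp
      ultimately show ?thesis
        by (simp add: f_def)
    qed
    then show "\<exists>H \<subseteq> {..<N}. card H = n \<and>
        (\<exists>d<c. \<forall>x\<in>H. \<forall>y\<in>H. \<forall>z\<in>H. x < y \<longrightarrow> y < z \<longrightarrow> g x y z = d)"
      using H d unfolding nsets_def by blast
  qed
qed

text \<open>Since points of \<open>P\<close> may repeat, \<open>h\<close> records which position
  each vertex of \<open>Q\<close> comes from. Its monotonicity carries increasing triples of
  \<open>Q\<close> to increasing triples of \<open>H\<close>.\<close>

lemma subseq_of_index_set:
  assumes "H \<subseteq> {..<length P}"
  obtains Q h where "subseq Q P" "length Q = card H"
    "\<And>i. i < length Q \<Longrightarrow> h i \<in> H \<and> Q ! i = P ! h i"
    "\<And>i j. i < j \<Longrightarrow> j < length Q \<Longrightarrow> h i < (h j :: nat)"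
proof -
  define xs where "xs = filter (\<lambda>i. i \<in> H) [0..<length P]"
  have set: "set xs = H"
    using assms by (auto simp: xs_def)
  have "sorted_wrt (<) xs"
    unfolding xs_def by (intro sorted_wrt_filter) simp
  then have mono: "xs ! i < xs ! j" if "i < j" "j < length xs" for i j
    using that by (simp add: sorted_wrt_iff_nth_less)
  have "distinct xs"
    by (simp add: xs_def)
  then have len: "length xs = card H"
    using set distinct_card by fastforce
  have "subseq (map ((!) P) xs) (map ((!) P) [0..<length P])"
    unfolding xs_def by (intro subseq_map subseq_filter_left)
  then have "subseq (map ((!) P) xs) P"
    by (simp add: map_nth)
  then show thesis
    by (rule that[of _ "(!) xs"]) (use set mono len in auto)
qed

lemma convex_sub_polygon:
  assumes "1 \<le> k"
  obtains N where "\<And>P :: polygon. N \<le> length P \<Longrightarrow>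
    \<exists>Q. subseq Q P \<and> length Q = k \<and> convex_polygon Q"
proof -
  obtain N where N: "\<And>g :: nat \<Rightarrow> nat \<Rightarrow> nat \<Rightarrow> nat. (\<forall>x y z. g x y z < 3) \<Longrightarrow>
    (\<exists>H \<subseteq> {..<N}. card H = k \<and>
      (\<exists>d<3. \<forall>x\<in>H. \<forall>y\<in>H. \<forall>z\<in>H. x < y \<longrightarrow> y < z \<longrightarrow> g x y z = d))"
    using ramsey_triples[of 3 k] by blast
  have "\<exists>Q. subseq Q P \<and> length Q = k \<and> convex_polygon Q" if P: "N \<le> length P" for P :: polygon
  proof -
    define g where "g x y z = (let r = orient (P ! x) (P ! y) (P ! z) in
      if r = 0 then 0 else if 0 < r then 1 else 2 :: nat)" for x y z
    have "\<forall>x y z. g x y z < 3"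
      by (simp add: g_def Let_def)
    from N[OF this] obtain H d where H: "H \<subseteq> {..<N}" "card H = k" and d: "d < 3"
      and "\<forall>x\<in>H. \<forall>y\<in>H. \<forall>z\<in>H. x < y \<longrightarrow> y < z \<longrightarrow> g x y z = d"
      by (elim exE conjE)
    then have gd: "g x y z = d" if "x \<in> H" "y \<in> H" "z \<in> H" "x < y" "y < z" for x y z
      using that by simp
    have "H \<subseteq> {..<length P}"
      using H P by force
    then obtain Q h where Q: "subseq Q P" "length Q = card H"
      and h: "\<And>i. i < length Q \<Longrightarrow> h i \<in> H \<and> Q ! i = P ! h i"
      and hmono: "\<And>i j. i < j \<Longrightarrow> j < length Q \<Longrightarrow> h i < h j"
      using subseq_of_index_set by blast
    have gQ: "g (h i) (h j) (h l) = d" if "i < j" "j < l" "l < length Q" for i j l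
      using that h hmono by (intro gd) auto
    have "convex_polygon Q"
    \<comment> \<open>With fewer than three vertices there are no triples and \<open>d\<close> says
      nothing about \<open>Q\<close>; such polygons are collinear and join the degenerate
      case.\<close>
    proof (cases "d = 0 \<or> length Q < 3")
      case True
      have "collinear (set Q)"
      proof (rule collinear_orient_zero)
        fix i j l assume *: "i < j" "j < l" "l < length Q"
        then have "d = 0"
          using True by auto
        then show "orient (Q ! i) (Q ! j) (Q ! l) = 0"
          using gQ[OF *] h * by (simp add: g_def Let_def split: if_splits)
      qed
      moreover have "Q \<noteq> []"
        using Q H assms by auto
      ultimately show ?thesis
        by (rule convex_polygon_collinear)
    next
      case False
      then have "d = 1 \<or> d = 2"
        using d by auto
      interpret oriented_polygon Q "if d = 1 then 1 else - 1"
      proof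
        show "3 \<le> length Q"
          using False by simp
        fix i j l assume *: "i < j" "j < l" "l < length Q"
        show "0 < (if d = 1 then 1 else - 1) * orient (Q ! i) (Q ! j) (Q ! l)"
          using gQ[OF *] h * \<open>d = 1 \<or> d = 2\<close> by (auto simp: g_def Let_def split: if_splits)
      qed
      show ?thesis
        by (rule convex_polygon)
    qed
    then show ?thesis
      using Q H by auto
  qed
  then show thesis
    by (rule that)
qed

theorem theorem4:
  shows "\<exists>F :: nat \<Rightarrow> nat. \<forall>k\<ge>1. F k \<ge> 1 \<and>
    (\<forall>P :: polygon. length P \<ge> F k \<longrightarrow>
      (\<exists>Q. subseq Q P \<and> length Q = k \<and> convex_polygon Q))"
proof -
  have "\<forall>k\<ge>1. \<exists>N\<ge>1. \<forall>P :: polygon. length P \<ge> N \<longrightarrow>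
      (\<exists>Q. subseq Q P \<and> length Q = k \<and> convex_polygon Q)"
  proof (intro allI impI)
    fix k :: nat
    assume "1 \<le> k"
    then obtain N where "\<And>P :: polygon. N \<le> length P \<Longrightarrow>
        \<exists>Q. subseq Q P \<and> length Q = k \<and> convex_polygon Q"
      using convex_sub_polygon by metis
    \<comment> \<open>The maximum with 1 is taken because the values of \<open>F\<close> must be
      positive.\<close>
    then show "\<exists>N\<ge>1. \<forall>P :: polygon. length P \<ge> N \<longrightarrow>
        (\<exists>Q. subseq Q P \<and> length Q = k \<and> convex_polygon Q)"
      by (intro exI[of _ "max 1 N"]) simp
  qed
  then show ?thesis
    by metis
qed

end
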